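(* Let $r,c\in\mathbb{R}^n$ be vectors with positive entries each summing to one, and let $A\in\mathbb{R}^{n\times n}$ be a matrix with strictly positive entries. Let $s=\sum_{ij}A_{ij}$ and $\ell=\min_{ij}A_{ij}$, and let $\varepsilon'>0$. Then the $\textsc{Sinkhorn}$ algorithm (described in the context) with stopping criterion $\mathrm{dist}(A^{(k)},\mathcal{U}_{r,c})=\|r(A^{(k)})-r\|_1+\|c(A^{(k)})-c\|_1$ outputs a matrix $B$ satisfying $\|r(B)-r\|_1+\|c(B)-c\|_1\le\varepsilon'$ in $O\big((\varepsilon')^{-2}\log(s/\ell)\big)$ iterations.
   Context: For $M\in\mathbb{R}^{n\times n}$, $r(M)=M\mathbf{1}$ and $c(M)=M^\top\mathbf{1}$ are its row and column sum vectors with coordinates $r_i(M)$, $c_j(M)$; $\|M\|_1=\sum_{ij}|M_{ij}|$; $\mathbf{D}(x)$ is the diagonal matrix with diagonal $x$, and $\exp$ of a vector is entrywise. $\mathcal{U}_{r,c}=\{P\in\mathbb{R}_+^{n\times n}:P\mathbf{1}=r,P^\top\mathbf{1}=c\}$. The $\textsc{Sinkhorn}(A,\mathcal{U}_{r,c},\varepsilon')$ algorithm: set $k=0$, $A^{(0)}=A/\|A\|_1$, $x^0=y^0=\mathbf{0}\in\mathbb{R}^n$. While $\|r(A^{(k)})-r\|_1+\|c(A^{(k)})-c\|_1>\varepsilon'$: increment $k$ by one (one iteration); if $k$ is odd, set $x^k_i=x^{k-1}_i+\log\frac{r_i}{r_i(A^{(k-1)})}$ for all $i\in[n]$ and $y^k=y^{k-1}$;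 if $k$ is even, set $y^k_j=y^{k-1}_j+\log\frac{c_j}{c_j(A^{(k-1)})}$ for all $j\in[n]$ and $x^k=x^{k-1}$; then set $A^{(k)}=\mathbf{D}(\exp(x^k))A^{(0)}\mathbf{D}(\exp(y^k))$. Output $B=A^{(k)}$. *)

theory Defs
  imports
    Complex_Main
    "HOL-Library.While_Combinator"
    "Jordan_Normal_Form.Matrix"
begin

definition ones_vec :: "nat \<Rightarrow> real vec" where
  "ones_vec n = vec n (\<lambda>_. 1)"

definition row_sums :: "real mat \<Rightarrow> real vec" where
  "row_sums M = M *\<^sub>v ones_vec (dim_col M)"

definition col_sums :: "real mat \<Rightarrow> real vec" where
  "col_sums M = transpose_mat M *\<^sub>v ones_vec (dim_row M)"

definition vec_l1 :: "real vec \<Rightarrow> real" where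
  "vec_l1 v = (\<Sum>i<dim_vec v. \<bar>v $ i\<bar>)"

(* entrywise, not the operator norm induced by vec_l1 *)
definition mat_l1 :: "real mat \<Rightarrow> real" where
  "mat_l1 M = sum_mat (map_mat abs M)"

definition diag_of_vec :: "real vec \<Rightarrow> real mat" where
  "diag_of_vec v = mat_diag (dim_vec v) (\<lambda>i. v $ i)"

definition marginal_dist :: "real vec \<Rightarrow> real vec \<Rightarrow> real mat \<Rightarrow> real" where
  "marginal_dist r c M = vec_l1 (row_sums M - r) + vec_l1 (col_sums M - c)"

(* (k, x^k, y^k, A^(k)); the first component is thus the number of iterations performed *)
type_synonym sinkhorn_state = "nat \<times> real vec \<times> real vec \<times> real mat"

definition normalized :: "real mat \<Rightarrow> real mat" where
  "normalized A = (1 / mat_l1 A) \<cdot>\<^sub>m A"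

definition sinkhorn_init :: "real mat \<Rightarrow> sinkhorn_state" where
  "sinkhorn_init A = (0, 0\<^sub>v (dim_row A), 0\<^sub>v (dim_col A), normalized A)"

fun sinkhorn_step :: "real vec \<Rightarrow> real vec \<Rightarrow> real mat \<Rightarrow> sinkhorn_state \<Rightarrow> sinkhorn_state" where
  "sinkhorn_step r c A (k, x, y, M) =
    (let k' = Suc k;
         x' = (if odd k' then vec (dim_vec x) (\<lambda>i. x $ i + ln (r $ i / row_sums M $ i)) else x);
         y' = (if even k' then vec (dim_vec y) (\<lambda>j. y $ j + ln (c $ j / col_sums M $ j)) else y)
     in (k', x', y', diag_of_vec (map_vec exp x') * normalized A * diag_of_vec (map_vec exp y')))"

(* The result is None exactly when the loop does not terminate. *)
definition sinkhorn ::
  "real mat \<Rightarrow> real vec \<Rightarrow> real vec \<Rightarrow> real \<Rightarrow> sinkhorn_state option" where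
  "sinkhorn A r c \<epsilon> =
    while_option (\<lambda>(k, x, y, M). marginal_dist r c M > \<epsilon>) (sinkhorn_step r c A) (sinkhorn_init A)"

end

theory Submission
  imports Defs "HOL-Analysis.Convex"
begin

text \<open>
  The dual objective \<open>g = \<langle>r, x\<^sup>k\<rangle> + \<langle>c, y\<^sup>k\<rangle>\<close> starts at \<open>0\<close> and grows in each iteration by the
  relative entropy of the target marginal with respect to the marginal being corrected. From the
  second iteration on the other marginal is exact, so a Pinsker-type inequality bounds the growth
  below by \<open>\<epsilon>\<^sup>2 / 4\<close> as long as the loop continues. On the other hand all entries of \<open>A\<^sup>k\<close>
  are at most \<open>1\<close>, so averaging \<open>ln A\<^sup>k\<^sub>i\<^sub>j = x\<^sub>i + y\<^sub>j + ln A\<^sup>0\<^sub>i\<^sub>j \<le> 0\<close> with weights \<open>r\<^sub>i c\<^sub>j\<close>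
  yields \<open>g \<le> ln (s / l)\<close>.
\<close>

section \<open>Relative entropy versus l1 distance\<close>

lemma ln_ge_two_minus_inverse_sqrt:
  fixes t :: real
  assumes "t > 0"
  shows "2 * (1 - 1 / sqrt t) \<le> ln t"
proof -
  \<comment> \<open>This is ln u <= u - 1 at u = 1 / sqrt t, where ln u = -(ln t) / 2. The square
    root is what produces the Hellinger terms later.\<close>
  have "ln (1 / sqrt t) \<le> 1 / sqrt t - 1"
    using assms by (intro ln_le_minus_one) simp
  then show ?thesis
    using assms by (simp add: ln_div ln_sqrt)
qed

text \<open>
  Pinsker's inequality with constant \<open>1/4\<close> instead of \<open>1/2\<close>, which comes from passing through the
  Hellinger distance \<open>\<Sum> (\<surd>p - \<surd>q)\<^sup>2\<close>.
\<close>
lemma relative_entropy_ge_l1_square: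
  fixes p q :: "'a \<Rightarrow> real"
  assumes p: "\<And>i. i \<in> I \<Longrightarrow> p i > 0" "sum p I = 1"
    and q: "\<And>i. i \<in> I \<Longrightarrow> q i > 0" "sum q I = 1"
  shows "(\<Sum>i\<in>I. \<bar>q i - p i\<bar>)\<^sup>2 / 4 \<le> (\<Sum>i\<in>I. p i * ln (p i / q i))"
proof -
  define H where "H = (\<Sum>i\<in>I. (sqrt (p i) - sqrt (q i))\<^sup>2)"
  have "H = (\<Sum>i\<in>I. p i + q i - 2 * (sqrt (p i) * sqrt (q i)))"
    unfolding H_def using p(1) q(1)
    by (intro sum.cong) (auto simp: power2_diff less_imp_le)
  \<comment> \<open>In general the summands differ; the sums agree because \<open>p\<close> and
    \<open>q\<close> have the same total mass.\<close>
  also have "\<dots> = (\<Sum>i\<in>I. 2 * (p i - sqrt (p i) * sqrt (q i)))"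
    by (simp add: sum.distrib sum_subtractf p q flip: sum_distrib_left)
  also have "\<dots> \<le> (\<Sum>i\<in>I. p i * ln (p i / q i))"
  proof (rule sum_mono)
    fix i assume i: "i \<in> I"
    have "p i / sqrt (p i) = sqrt (p i)"
      using p(1)[OF i] by (simp add: real_div_sqrt)
    then have "p i * (1 / sqrt (p i / q i)) = sqrt (p i) * sqrt (q i)"
      by (metis real_sqrt_divide divide_divide_eq_right mult_1 times_divide_eq_left
          times_divide_eq_right)
    then have "2 * (p i - sqrt (p i) * sqrt (q i)) = p i * (2 * (1 - 1 / sqrt (p i / q i)))"
      by (simp add: right_diff_distrib mult.left_commute[of _ 2] del: times_divide_eq_right)
    also have "\<dots> \<le> p i * ln (p i / q i)"
      using p(1)[OF i] q(1)[OF i]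
      by (intro mult_left_mono ln_ge_two_minus_inverse_sqrt) (auto simp: less_imp_le)
    finally show "2 * (p i - sqrt (p i) * sqrt (q i)) \<le> p i * ln (p i / q i)" .
  qed
  finally have H_le: "H \<le> (\<Sum>i\<in>I. p i * ln (p i / q i))" .
  \<comment> \<open>The second Cauchy-Schwarz factor: (a + b)^2 <= 2 (a^2 + b^2), and each of the
    two masses contributes 2. This is the source of the 4.\<close>
  have "(\<Sum>i\<in>I. (sqrt (p i) + sqrt (q i))\<^sup>2) \<le> (\<Sum>i\<in>I. 2 * (p i + q i))"
  proof (rule sum_mono)
    fix i assume i: "i \<in> I"
    have "0 \<le> (sqrt (p i) - sqrt (q i))\<^sup>2"
      by simp
    then show "(sqrt (p i) + sqrt (q i))\<^sup>2 \<le> 2 * (p i + q i)"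
      using p(1)[OF i] q(1)[OF i] by (simp add: power2_diff power2_sum)
  qed
  also have "\<dots> = 4"
    by (simp add: sum.distrib p q flip: sum_distrib_left)
  finally have plus_le: "(\<Sum>i\<in>I. (sqrt (p i) + sqrt (q i))\<^sup>2) \<le> 4" .
  \<comment> \<open>A difference of squares splits each term into a Hellinger factor and a factor
    with bounded square sum.\<close>
  have "\<bar>q i - p i\<bar> = \<bar>sqrt (p i) - sqrt (q i)\<bar> * (sqrt (p i) + sqrt (q i))" if "i \<in> I" for i
  proof -
    have "q i - p i = - ((sqrt (p i) - sqrt (q i)) * (sqrt (p i) + sqrt (q i)))"
      using p(1)[OF that] q(1)[OF that] by (simp add: algebra_simps)
    then show ?thesis
      using p(1)[OF that] q(1)[OF that] by (simp add: abs_mult)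
  qed
  then have "(\<Sum>i\<in>I. \<bar>q i - p i\<bar>)\<^sup>2 =
      (\<Sum>i\<in>I. \<bar>sqrt (p i) - sqrt (q i)\<bar> * (sqrt (p i) + sqrt (q i)))\<^sup>2"
    by simp
  also have "\<dots> \<le> H * (\<Sum>i\<in>I. (sqrt (p i) + sqrt (q i))\<^sup>2)"
    using Cauchy_Schwarz_ineq_sum[of "\<lambda>i. \<bar>sqrt (p i) - sqrt (q i)\<bar>" _ I]
    by (simp add: H_def)
  also have "\<dots> \<le> H * 4"
    by (intro mult_left_mono plus_le) (simp add: H_def sum_nonneg)
  finally show ?thesis
    using H_le by simp
qed

section \<open>Termination of a loop from a bound on its runs\<close>

text \<open>The hypothesis serves twice: past \<open>K\<close> it rules out an infinite run, and at
  the least index failing the test it bounds the number of iterations.\<close>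

lemma while_option_Some_if_bounded:
  fixes K :: real
  assumes "\<And>k. (\<And>j. j < k \<Longrightarrow> b ((f ^^ j) s)) \<Longrightarrow> real k \<le> K"
  obtains k where "while_option b f s = Some ((f ^^ k) s)" "\<not> b ((f ^^ k) s)" "real k \<le> K"
proof -
  have ex: "\<exists>k. \<not> b ((f ^^ k) s)"
  proof (rule ccontr)
    assume "\<nexists>k. \<not> b ((f ^^ k) s)"
    then have "real (nat \<lfloor>K\<rfloor> + 1) \<le> K"
      by (intro assms) auto
    then show False
      by linarith
  qed
  define k where "k = (LEAST k. \<not> b ((f ^^ k) s))"
  show thesis
  proof (rule that[of k])
    show "while_option b f s = Some ((f ^^ k) s)"
      unfolding while_option_def k_def using ex by simp
    show "\<not> b ((f ^^ k) s)"
      unfolding k_def using ex by (rule LeastI_ex)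
    show "real k \<le> K"
      unfolding k_def by (rule assms) (use not_less_Least in blast)
  qed
qed

section \<open>Marginals, l1 norms and diagonal scaling in coordinates\<close>

lemma dim_row_sums [simp]: "dim_vec (row_sums M) = dim_row M"
  by (simp add: row_sums_def)

lemma dim_col_sums [simp]: "dim_vec (col_sums M) = dim_col M"
  by (simp add: col_sums_def)

lemma row_sums_index:
  assumes "M \<in> carrier_mat m n" "i < m"
  shows "row_sums M $ i = (\<Sum>j<n. M $$ (i, j))"
  using assms by (auto simp: row_sums_def ones_vec_def scalar_prod_def atLeast0LessThan)

lemma col_sums_index:
  assumes "M \<in> carrier_mat m n" "j < n"
  shows "col_sums M $ j = (\<Sum>i<m. M $$ (i, j))"
  using assms by (auto simp: col_sums_def ones_vec_def scalar_prod_def atLeast0LessThan)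

lemma sum_row_sums:
  assumes "M \<in> carrier_mat m n"
  shows "(\<Sum>i<m. row_sums M $ i) = (\<Sum>i<m. \<Sum>j<n. M $$ (i, j))"
  using assms by (simp add: row_sums_index)

lemma sum_col_sums:
  assumes "M \<in> carrier_mat m n"
  shows "(\<Sum>j<n. col_sums M $ j) = (\<Sum>i<m. \<Sum>j<n. M $$ (i, j))"
  using assms by (subst sum.swap) (simp add: col_sums_index)

lemma vec_l1_diff_self [simp]: "vec_l1 (v - v) = 0"
  by (simp add: vec_l1_def)

lemma vec_l1_diff:
  assumes "v \<in> carrier_vec n"
  shows "vec_l1 (u - v) = (\<Sum>i<n. \<bar>u $ i - v $ i\<bar>)"
  using assms by (auto simp: vec_l1_def)

lemma vec_l1_diff_le_2:
  assumes v: "v \<in> carrier_vec n"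
    and "\<And>i. i < n \<Longrightarrow> u $ i > 0" "(\<Sum>i<n. u $ i) = 1"
    and "\<And>i. i < n \<Longrightarrow> v $ i > 0" "(\<Sum>i<n. v $ i) = 1"
  shows "vec_l1 (u - v) \<le> 2"
proof -
  have "vec_l1 (u - v) = (\<Sum>i<n. \<bar>u $ i - v $ i\<bar>)"
    by (rule vec_l1_diff[OF v])
  also have "\<dots> \<le> (\<Sum>i<n. u $ i + v $ i)"
    by (rule sum_mono) (use assms(2,4) in \<open>fastforce simp: abs_if\<close>)
  also have "\<dots> = 2"
    using assms by (simp add: sum.distrib)
  finally show ?thesis .
qed

lemma mat_l1_eq:
  assumes "M \<in> carrier_mat m n"
  shows "mat_l1 M = (\<Sum>i<m. \<Sum>j<n. \<bar>M $$ (i, j)\<bar>)"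
proof -
  have "mat_l1 M = (\<Sum>(i, j)\<in>{..<m} \<times> {..<n}. \<bar>M $$ (i, j)\<bar>)"
    using assms unfolding mat_l1_def sum_mat_def
    by (intro sum.cong) (auto simp: atLeast0LessThan)
  then show ?thesis
    by (simp add: sum.cartesian_product)
qed

lemma diag_scaled_carrier:
  assumes "x \<in> carrier_vec m" "y \<in> carrier_vec n" "M \<in> carrier_mat m n"
  shows "diag_of_vec x * M * diag_of_vec y \<in> carrier_mat m n"
  using assms by (intro mult_carrier_mat) (auto simp: diag_of_vec_def)

lemma diag_scaled_index:
  assumes "x \<in> carrier_vec m" "y \<in> carrier_vec n" "M \<in> carrier_mat m n" "i < m" "j < n"
  shows "(diag_of_vec x * M * diag_of_vec y) $$ (i, j) = x $ i * M $$ (i, j) * y $ j"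
proof -
  have "diag_of_vec x * M = mat m n (\<lambda>(i, j). x $ i * M $$ (i, j))"
    using assms by (auto simp: diag_of_vec_def mat_diag_mult_left)
  then show ?thesis
    using assms by (auto simp: diag_of_vec_def mat_diag_mult_right[of _ m])
qed

section \<open>The input matrix and lower bounds on the logarithm\<close>

locale sinkhorn_input =
  fixes n :: nat and r c :: "real vec" and A :: "real mat"
  assumes r_carrier [simp]: "r \<in> carrier_vec n"
    and r_pos: "i < n \<Longrightarrow> r $ i > 0"
    and r_sum: "(\<Sum>i<n. r $ i) = 1"
    and c_carrier [simp]: "c \<in> carrier_vec n"
    and c_pos: "j < n \<Longrightarrow> c $ j > 0"
    and c_sum: "(\<Sum>j<n. c $ j) = 1"
    and A_carrier: "A \<in> carrier_mat n n"
    and A_pos: "i < n \<Longrightarrow> j < n \<Longrightarrow> A $$ (i, j) > 0"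
begin

lemma dims [simp]:
  "dim_vec r = n" "dim_vec c = n" "dim_row A = n" "dim_col A = n"
  using carrier_vecD[OF r_carrier] carrier_vecD[OF c_carrier] carrier_matD[OF A_carrier] by auto

definition total :: real where
  "total = (\<Sum>i<n. \<Sum>j<n. A $$ (i, j))"

definition least_entry :: real where
  "least_entry = Min {A $$ (i, j) | i j. i < n \<and> j < n}"

lemma n_pos: "n > 0"
  using r_sum by (cases n) auto

lemma total_pos: "total > 0"
  unfolding total_def using n_pos A_pos by (intro sum_pos) (auto intro!: sum_pos)

lemma mat_l1_A: "mat_l1 A = total"
  unfolding mat_l1_eq[OF A_carrier] total_def
  by (intro sum.cong) (auto intro!: abs_of_pos A_pos)

lemma normalized_carrier [simp]: "normalized A \<in> carrier_mat n n"
  using A_carrier by (simp add: normalized_def)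

lemma dims_normalized [simp]: "dim_row (normalized A) = n" "dim_col (normalized A) = n"
  by (simp_all add: normalized_def)

lemma normalized_index:
  "i < n \<Longrightarrow> j < n \<Longrightarrow> normalized A $$ (i, j) = A $$ (i, j) / total"
  using A_carrier by (simp add: normalized_def mat_l1_A)

lemma normalized_sum: "(\<Sum>i<n. \<Sum>j<n. normalized A $$ (i, j)) = 1"
  using total_pos by (simp add: normalized_index total_def flip: sum_divide_distrib)

lemma finite_entries: "finite {A $$ (i, j) | i j. i < n \<and> j < n}"
proof -
  have "{A $$ (i, j) | i j. i < n \<and> j < n} = (\<lambda>(i, j). A $$ (i, j)) ` ({..<n} \<times> {..<n})"
    by auto
  then show ?thesis
    by simp
qed

lemma least_entry_le: "i < n \<Longrightarrow> j < n \<Longrightarrow> least_entry \<le> A $$ (i, j)"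
  unfolding least_entry_def by (rule Min_le[OF finite_entries]) auto

lemma least_entry_pos: "least_entry > 0"
  unfolding least_entry_def using n_pos A_pos
  by (subst Min_gr_iff[OF finite_entries]) auto

lemma total_over_least_ge: "(real n)\<^sup>2 \<le> total / least_entry"
proof -
  have "(\<Sum>i<n. \<Sum>j<n. least_entry) \<le> total"
    unfolding total_def by (intro sum_mono least_entry_le) auto
  then show ?thesis
    using least_entry_pos by (simp add: field_simps power2_eq_square)
qed

lemma ln_total_over_least_nonneg: "0 \<le> ln (total / least_entry)"
proof -
  have "1 \<le> (real n)\<^sup>2"
    using n_pos by simp
  then have "1 \<le> total / least_entry"
    using total_over_least_ge by linarith
  then show ?thesis
    by simp
qed

text \<open>The final bound has no additive term, so the logarithm must absorb the first iteration,
  for which no gain is guaranteed. It can, since s / l >= n^2 >= 4 exceeds e. For n = 1 the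
  logarithm is 0 and a separate argument is used.\<close>

lemma ln_total_over_least_ge_1:
  assumes "n \<ge> 2"
  shows "1 \<le> ln (total / least_entry)"
proof -
  have "(2::real)\<^sup>2 \<le> (real n)\<^sup>2"
    using assms by (intro power_mono) auto
  then have "exp 1 \<le> total / least_entry"
    using exp_le total_over_least_ge by simp
  then show ?thesis
    using total_pos least_entry_pos by (simp add: ln_ge_iff)
qed

section \<open>Scaled matrices and the dual objective\<close>

definition scaled :: "real vec \<Rightarrow> real vec \<Rightarrow> real mat" where
  "scaled x y = diag_of_vec (map_vec exp x) * normalized A * diag_of_vec (map_vec exp y)"

text \<open>Mass 1 makes both marginals probability vectors, as the entropy inequality requires, and
  keeps every entry at most 1, as the bound on \<open>dual\<close> requires.\<close>

definition feasible :: "real vec \<Rightarrow> real vec \<Rightarrow> bool" where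
  "feasible x y \<longleftrightarrow> x \<in> carrier_vec n \<and> y \<in> carrier_vec n \<and>
    (\<Sum>i<n. \<Sum>j<n. scaled x y $$ (i, j)) = 1"

text \<open>The usual concave dual of matrix scaling also subtracts the total mass of the scaled
  matrix; on feasible pairs that term is constant and is left out.\<close>

definition dual :: "real vec \<Rightarrow> real vec \<Rightarrow> real" where
  "dual x y = (\<Sum>i<n. r $ i * x $ i) + (\<Sum>j<n. c $ j * y $ j)"

lemma scaled_carrier:
  "x \<in> carrier_vec n \<Longrightarrow> y \<in> carrier_vec n \<Longrightarrow> scaled x y \<in> carrier_mat n n"
  unfolding scaled_def by (rule diag_scaled_carrier) auto

lemma scaled_index:
  assumes "x \<in> carrier_vec n" "y \<in> carrier_vec n" "i < n" "j < n"
  shows "scaled x y $$ (i, j) = exp (x $ i) * (A $$ (i, j) / total) * exp (y $ j)"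
  unfolding scaled_def using assms by (subst diag_scaled_index) (auto simp: normalized_index)

lemma scaled_pos:
  "x \<in> carrier_vec n \<Longrightarrow> y \<in> carrier_vec n \<Longrightarrow> i < n \<Longrightarrow> j < n \<Longrightarrow> scaled x y $$ (i, j) > 0"
  using A_pos total_pos by (simp add: scaled_index)

lemma scaled_zero: "scaled (0\<^sub>v n) (0\<^sub>v n) = normalized A"
proof (rule eq_matI)
  show "scaled (0\<^sub>v n) (0\<^sub>v n) $$ (i, j) = normalized A $$ (i, j)"
    if "i < dim_row (normalized A)" "j < dim_col (normalized A)" for i j
    using that by (simp add: scaled_index normalized_index)
qed (use scaled_carrier[of "0\<^sub>v n" "0\<^sub>v n"] in auto)

lemma feasible_zero: "feasible (0\<^sub>v n) (0\<^sub>v n)"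
  by (simp add: feasible_def scaled_zero normalized_sum)

lemma row_sums_scaled_pos:
  assumes "x \<in> carrier_vec n" "y \<in> carrier_vec n" "i < n"
  shows "row_sums (scaled x y) $ i > 0"
  unfolding row_sums_index[OF scaled_carrier[OF assms(1,2)] assms(3)]
  using n_pos assms by (intro sum_pos) (auto intro: scaled_pos)

lemma col_sums_scaled_pos:
  assumes "x \<in> carrier_vec n" "y \<in> carrier_vec n" "j < n"
  shows "col_sums (scaled x y) $ j > 0"
  unfolding col_sums_index[OF scaled_carrier[OF assms(1,2)] assms(3)]
  using n_pos assms by (intro sum_pos) (auto intro: scaled_pos)

lemma scaled_sums:
  assumes "feasible x y"
  shows "(\<Sum>i<n. row_sums (scaled x y) $ i) = 1" "(\<Sum>j<n. col_sums (scaled x y) $ j) = 1"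
  using assms scaled_carrier[of x y]
  by (auto simp: feasible_def sum_row_sums sum_col_sums)

lemma dual_le:
  assumes "feasible x y"
  shows "dual x y \<le> ln (total / least_entry)"
proof -
  have xy: "x \<in> carrier_vec n" "y \<in> carrier_vec n"
    and sum1: "(\<Sum>i<n. \<Sum>j<n. scaled x y $$ (i, j)) = 1"
    using assms by (auto simp: feasible_def)
  have entry: "x $ i + y $ j \<le> ln (total / least_entry)" if "i < n" "j < n" for i j
  proof -
    have "scaled x y $$ (i, j) \<le> (\<Sum>j<n. scaled x y $$ (i, j))"
      using that xy by (intro member_le_sum) (auto intro: less_imp_le scaled_pos)
    also have "\<dots> \<le> (\<Sum>i<n. \<Sum>j<n. scaled x y $$ (i, j))"
      using that xy
      by (intro member_le_sum[where f = "\<lambda>i. \<Sum>j<n. scaled x y $$ (i, j)"])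
        (auto intro!: sum_nonneg intro: less_imp_le scaled_pos)
    finally have "exp (x $ i) * (A $$ (i, j) / total) * exp (y $ j) \<le> 1"
      using that xy sum1 by (simp add: scaled_index)
    then have "exp (x $ i + y $ j) * A $$ (i, j) \<le> total"
      using total_pos by (simp add: exp_add field_simps)
    \<comment> \<open>Passing to the least entry makes the bound uniform in \<open>i\<close> and
      \<open>j\<close>, so that it survives averaging.\<close>
    then have "exp (x $ i + y $ j) * least_entry \<le> total"
      using least_entry_le[OF that]
      by (meson exp_ge_zero mult_left_mono order_trans)
    then have "exp (x $ i + y $ j) \<le> total / least_entry"
      using least_entry_pos by (simp add: field_simps)
    then show ?thesis
      using total_pos least_entry_pos by (simp add: ln_ge_iff)
  qed
  \<comment> \<open>Each of the two linear forms is multiplied by the total mass 1 of the other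
    weight vector; this turns \<open>dual\<close> into an average over the product weights.\<close>
  have "dual x y = (\<Sum>i<n. \<Sum>j<n. r $ i * c $ j * (x $ i + y $ j))"
  proof -
    have "(\<Sum>i<n. r $ i * x $ i) * (\<Sum>j<n. c $ j) + (\<Sum>i<n. r $ i) * (\<Sum>j<n. c $ j * y $ j) =
        (\<Sum>i<n. \<Sum>j<n. r $ i * c $ j * (x $ i + y $ j))"
      unfolding sum_product by (simp add: distrib_left sum.distrib mult_ac)
    then show ?thesis
      by (simp add: dual_def r_sum c_sum)
  qed
  also have "\<dots> \<le> (\<Sum>i<n. \<Sum>j<n. r $ i * c $ j * ln (total / least_entry))"
    by (intro sum_mono mult_left_mono entry) (simp_all add: r_pos c_pos less_imp_le)
  also have "\<dots> = (\<Sum>i<n. r $ i) * (\<Sum>j<n. c $ j) * ln (total / least_entry)"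
    unfolding sum_product by (simp only: sum_distrib_right)
  finally show ?thesis
    by (simp add: r_sum c_sum)
qed

section \<open>Effect of one row or column correction\<close>

definition row_update :: "real vec \<Rightarrow> real vec \<Rightarrow> real vec" where
  "row_update x y = vec n (\<lambda>i. x $ i + ln (r $ i / row_sums (scaled x y) $ i))"

definition col_update :: "real vec \<Rightarrow> real vec \<Rightarrow> real vec" where
  "col_update x y = vec n (\<lambda>j. y $ j + ln (c $ j / col_sums (scaled x y) $ j))"

text \<open>Row \<open>i\<close> as a whole is multiplied by its target sum over its current sum, so
  the rows become exact, and the mass stays 1 because \<open>r\<close> sums to 1. The column sums
  may be spoiled.\<close>

lemma row_update:
  assumes "feasible x y"
  shows "feasible (row_update x y) y"
    and "row_sums (scaled (row_update x y) y) = r"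
    and "dual x y + (vec_l1 (row_sums (scaled x y) - r))\<^sup>2 / 4 \<le> dual (row_update x y) y"
proof -
  let ?x = "row_update x y"
  have xy [simp]: "x \<in> carrier_vec n" "y \<in> carrier_vec n" "?x \<in> carrier_vec n"
    using assms by (auto simp: feasible_def row_update_def)
  have pos: "row_sums (scaled x y) $ i > 0" if "i < n" for i
    using that by (intro row_sums_scaled_pos) auto
  have entry: "scaled ?x y $$ (i, j) = r $ i / row_sums (scaled x y) $ i * scaled x y $$ (i, j)"
    if "i < n" "j < n" for i j
    using that r_pos[of i] pos[of i]
    by (simp add: scaled_index) (simp add: row_update_def exp_add)
  show rows: "row_sums (scaled ?x y) = r"
  proof (rule eq_vecI)
    fix i assume "i < dim_vec r"
    then have i: "i < n"
      using r_carrier by auto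
    have "row_sums (scaled ?x y) $ i =
        (\<Sum>j<n. r $ i / row_sums (scaled x y) $ i * scaled x y $$ (i, j))"
      using i by (simp add: row_sums_index[OF scaled_carrier] entry)
    also have "\<dots> = r $ i / row_sums (scaled x y) $ i * row_sums (scaled x y) $ i"
      using i by (simp add: row_sums_index[OF scaled_carrier] sum_distrib_left)
    finally show "row_sums (scaled ?x y) $ i = r $ i"
      using pos[OF i] by simp
  qed (use scaled_carrier[of ?x y] in auto)
  show "feasible ?x y"
    using rows r_sum sum_row_sums[OF scaled_carrier[of ?x y]] by (simp add: feasible_def)
  \<comment> \<open>Only the \<open>x\<close> part of \<open>dual\<close> moves, and its increment
    is exactly the relative entropy of \<open>r\<close> with respect to the old row sums.\<close>
  have "dual ?x y = dual x y + (\<Sum>i<n. r $ i * ln (r $ i / row_sums (scaled x y) $ i))"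
    by (simp add: dual_def row_update_def distrib_left sum.distrib)
  moreover have "(vec_l1 (row_sums (scaled x y) - r))\<^sup>2 / 4 \<le>
      (\<Sum>i<n. r $ i * ln (r $ i / row_sums (scaled x y) $ i))"
    unfolding vec_l1_diff[OF r_carrier]
    by (rule relative_entropy_ge_l1_square) (auto simp: r_pos r_sum pos scaled_sums assms)
  ultimately show "dual x y + (vec_l1 (row_sums (scaled x y) - r))\<^sup>2 / 4 \<le> dual ?x y"
    by simp
qed

text \<open>Mirror image of \<open>row_update\<close>: whole columns are rescaled, and the mass
  stays 1 because \<open>c\<close> sums to 1.\<close>

lemma col_update:
  assumes "feasible x y"
  shows "feasible x (col_update x y)"
    and "col_sums (scaled x (col_update x y)) = c"
    and "dual x y + (vec_l1 (col_sums (scaled x y) - c))\<^sup>2 / 4 \<le> dual x (col_update x y)"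
proof -
  let ?y = "col_update x y"
  have xy [simp]: "x \<in> carrier_vec n" "y \<in> carrier_vec n" "?y \<in> carrier_vec n"
    using assms by (auto simp: feasible_def col_update_def)
  have pos: "col_sums (scaled x y) $ j > 0" if "j < n" for j
    using that by (intro col_sums_scaled_pos) auto
  have entry: "scaled x ?y $$ (i, j) = c $ j / col_sums (scaled x y) $ j * scaled x y $$ (i, j)"
    if "i < n" "j < n" for i j
    using that c_pos[of j] pos[of j]
    by (simp add: scaled_index) (simp add: col_update_def exp_add)
  show cols: "col_sums (scaled x ?y) = c"
  proof (rule eq_vecI)
    fix j assume "j < dim_vec c"
    then have j: "j < n"
      using c_carrier by auto
    have "col_sums (scaled x ?y) $ j =
        (\<Sum>i<n. c $ j / col_sums (scaled x y) $ j * scaled x y $$ (i, j))"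
      using j by (simp add: col_sums_index[OF scaled_carrier] entry)
    also have "\<dots> = c $ j / col_sums (scaled x y) $ j * col_sums (scaled x y) $ j"
      using j by (simp add: col_sums_index[OF scaled_carrier] sum_distrib_left)
    finally show "col_sums (scaled x ?y) $ j = c $ j"
      using pos[OF j] by simp
  qed (use scaled_carrier[of x ?y] in auto)
  show "feasible x ?y"
    using cols c_sum sum_col_sums[OF scaled_carrier[of x ?y]] by (simp add: feasible_def)
  have "dual x ?y = dual x y + (\<Sum>j<n. c $ j * ln (c $ j / col_sums (scaled x y) $ j))"
    by (simp add: dual_def col_update_def distrib_left sum.distrib)
  moreover have "(vec_l1 (col_sums (scaled x y) - c))\<^sup>2 / 4 \<le>
      (\<Sum>j<n. c $ j * ln (c $ j / col_sums (scaled x y) $ j))"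
    unfolding vec_l1_diff[OF c_carrier]
    by (rule relative_entropy_ge_l1_square) (auto simp: c_pos c_sum pos scaled_sums assms)
  ultimately show "dual x y + (vec_l1 (col_sums (scaled x y) - c))\<^sup>2 / 4 \<le> dual x ?y"
    by simp
qed

section \<open>Iterates of the algorithm and their accumulated gain\<close>

text \<open>The algorithm tests the parity of the incremented counter, so an even \<open>k\<close>
  triggers a row correction. The matrix component remains a function of the two potentials, which
  lets the analysis follow these alone.\<close>

lemma sinkhorn_step_scaled:
  assumes "feasible x y"
  shows "sinkhorn_step r c A (k, x, y, scaled x y) =
    (if even k then (Suc k, row_update x y, y, scaled (row_update x y) y)
     else (Suc k, x, col_update x y, scaled x (col_update x y)))"
  using assms
  by (auto simp: feasible_def Let_def row_update_def col_update_def scaled_def)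

text \<open>Iteration without the stopping test; \<open>running\<close> supplies the test
  separately.\<close>

definition iterate :: "nat \<Rightarrow> sinkhorn_state" where
  "iterate k = (sinkhorn_step r c A ^^ k) (sinkhorn_init A)"

definition running :: "real \<Rightarrow> sinkhorn_state \<Rightarrow> bool" where
  "running \<epsilon> = (\<lambda>(k, x, y, M). marginal_dist r c M > \<epsilon>)"

lemma iterate_0: "iterate 0 = (0, 0\<^sub>v n, 0\<^sub>v n, scaled (0\<^sub>v n) (0\<^sub>v n))"
  using A_carrier by (auto simp: iterate_def sinkhorn_init_def scaled_zero)

text \<open>
  The truncated difference \<open>k - 1\<close> reflects that the first iteration need not gain \<open>\<epsilon>\<^sup>2 / 4\<close>,
  because initially the error may come from the column sums alone.
\<close>
lemma iterate_invariant:
  assumes "\<epsilon> > 0" "\<And>j. j < k \<Longrightarrow> running \<epsilon> (iterate j)"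
  obtains x y where "iterate k = (k, x, y, scaled x y)" "feasible x y"
    "odd k \<Longrightarrow> row_sums (scaled x y) = r"
    "even k \<Longrightarrow> k > 0 \<Longrightarrow> col_sums (scaled x y) = c"
    "real (k - 1) * (\<epsilon>\<^sup>2 / 4) \<le> dual x y"
  using assms(2)
proof (induction k arbitrary: thesis)
  case 0
  show ?case
    by (rule 0(1)[OF iterate_0 feasible_zero]) (auto simp: dual_def)
next
  case (Suc k)
  obtain x y where it: "iterate k = (k, x, y, scaled x y)" and feas: "feasible x y"
    and row: "odd k \<Longrightarrow> row_sums (scaled x y) = r"
    and col: "even k \<Longrightarrow> k > 0 \<Longrightarrow> col_sums (scaled x y) = c"
    and gain: "real (k - 1) * (\<epsilon>\<^sup>2 / 4) \<le> dual x y"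
    using Suc.IH Suc.prems(2) by (metis less_Suc_eq)
  have run: "marginal_dist r c (scaled x y) > \<epsilon>"
    using Suc.prems(2)[of k] by (simp add: running_def it)
  have step: "iterate (Suc k) = sinkhorn_step r c A (k, x, y, scaled x y)"
    by (simp add: iterate_def flip: it)
  \<comment> \<open>Here \<open>d\<close> is the l1 error of the marginal about to be corrected. For
    \<open>k > 0\<close> the other marginal is exact, so \<open>d\<close> is the whole stopping
    distance; for \<open>k = 0\<close> the gain to be shown is 0.\<close>
  have square_gain: "real k * (\<epsilon>\<^sup>2 / 4) \<le> dual x y + d\<^sup>2 / 4" if "k > 0 \<Longrightarrow> d > \<epsilon>" for d
  proof (cases "k = 0")
    case True
    then show ?thesis
      using gain by (simp add: add_nonneg_nonneg)
  next
    case False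
    then have "\<epsilon>\<^sup>2 \<le> d\<^sup>2"
      using that assms(1) by (intro power_mono) auto
    then show ?thesis
      using gain False by (simp add: of_nat_diff algebra_simps)
  qed
  show ?case
  proof (cases "even k")
    case True
    note upd = row_update[OF feas]
    have "real k * (\<epsilon>\<^sup>2 / 4) \<le> dual (row_update x y) y"
      using run True col by (intro order_trans[OF square_gain upd(3)]) (simp add: marginal_dist_def)
    then show ?thesis
      using True upd by (intro Suc.prems(1)) (auto simp: step sinkhorn_step_scaled[OF feas]
          simp del: sinkhorn_step.simps)
  next
    case False
    note upd = col_update[OF feas]
    have "real k * (\<epsilon>\<^sup>2 / 4) \<le> dual x (col_update x y)"
      using run False row by (intro order_trans[OF square_gain upd(3)]) (simp add: marginal_dist_def)
    then show ?thesis
      using False upd by (intro Suc.prems(1)) (auto simp: step sinkhorn_step_scaled[OF feas]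
          simp del: sinkhorn_step.simps)
  qed
qed

section \<open>Counting the iterations\<close>

lemma initial_dist_le_4: "marginal_dist r c (scaled (0\<^sub>v n) (0\<^sub>v n)) \<le> 4"
proof -
  let ?M = "scaled (0\<^sub>v n) (0\<^sub>v n)"
  have "vec_l1 (row_sums ?M - r) \<le> 2" "vec_l1 (col_sums ?M - c) \<le> 2"
    by (rule vec_l1_diff_le_2[OF r_carrier] vec_l1_diff_le_2[OF c_carrier];
        simp add: scaled_sums[OF feasible_zero] row_sums_scaled_pos col_sums_scaled_pos
          r_pos c_pos r_sum c_sum)+
  then show ?thesis
    by (simp add: marginal_dist_def)
qed

text \<open>The only entry of each marginal is 1, so the loop stops at once, in agreement with a
  bound whose logarithm is 0.\<close>

lemma initial_dist_eq_0:
  assumes "n = 1"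
  shows "marginal_dist r c (scaled (0\<^sub>v n) (0\<^sub>v n)) = 0"
  using scaled_sums[OF feasible_zero] r_sum c_sum assms
  by (simp add: marginal_dist_def vec_l1_diff[OF r_carrier] vec_l1_diff[OF c_carrier])

text \<open>All iterations but the first are paid for by the dual objective, at a cost of 4L. The
  first costs another 16L: that the loop starts at all forces a tolerance below 4 and n >= 2, hence
  L >= 1. Together this gives 20.\<close>

lemma iterations_bound:
  assumes "\<epsilon> > 0" and run: "\<And>j. j < k \<Longrightarrow> running \<epsilon> (iterate j)"
  shows "real k \<le> 20 * (ln (total / least_entry) / \<epsilon>\<^sup>2)"
proof (cases "k = 0")
  case True
  then show ?thesis
    using ln_total_over_least_nonneg by simp
next
  case False
  define L where "L = ln (total / least_entry)"
  have init: "\<epsilon> < marginal_dist r c (scaled (0\<^sub>v n) (0\<^sub>v n))"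
    using run[of 0] False by (simp add: running_def iterate_0)
  then have "n \<noteq> 1"
    using initial_dist_eq_0 assms(1) by auto
  then have L: "1 \<le> L"
    using ln_total_over_least_ge_1 n_pos by (simp add: L_def)
  have "\<epsilon>\<^sup>2 \<le> 4\<^sup>2"
    using init initial_dist_le_4 assms(1) by (intro power_mono) auto
  then have "\<epsilon>\<^sup>2 \<le> 16 * L"
    using L by simp
  obtain x y where "feasible x y" "real (k - 1) * (\<epsilon>\<^sup>2 / 4) \<le> dual x y"
    using iterate_invariant[OF assms(1) run] by metis
  then have "real (k - 1) * \<epsilon>\<^sup>2 \<le> 4 * L"
    using dual_le[of x y] by (simp add: L_def)
  with \<open>\<epsilon>\<^sup>2 \<le> 16 * L\<close> have "real k * \<epsilon>\<^sup>2 \<le> 20 * L"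
    using False by (simp add: of_nat_diff algebra_simps)
  then show ?thesis
    using assms(1) by (simp add: L_def field_simps)
qed

lemma sinkhorn_converges:
  assumes "\<epsilon> > 0"
  obtains k x y B where "sinkhorn A r c \<epsilon> = Some (k, x, y, B)" "marginal_dist r c B \<le> \<epsilon>"
    "real k \<le> 20 * (ln (total / least_entry) / \<epsilon>\<^sup>2)"
proof -
  obtain k where "sinkhorn A r c \<epsilon> = Some (iterate k)" and stop: "\<not> running \<epsilon> (iterate k)"
    and bound: "real k \<le> 20 * (ln (total / least_entry) / \<epsilon>\<^sup>2)"
    using while_option_Some_if_bounded[of "running \<epsilon>" "sinkhorn_step r c A" "sinkhorn_init A"]
      iterations_bound[OF assms]
    by (auto simp: iterate_def sinkhorn_def running_def)
  \<comment> \<open>Each step increments the stored counter, so the counter returned equals the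
    index of the iterate and inherits its bound.\<close>
  moreover have "fst (sinkhorn_step r c A S) = Suc (fst S)" for S
    by (cases S) (simp add: Let_def)
  then have "fst (iterate k) = k" for k
    by (induction k) (simp_all add: iterate_def sinkhorn_init_def)
  ultimately show thesis
    using that bound
    by (cases "iterate k") (metis (mono_tags, lifting) case_prod_conv fst_conv not_less running_def)
qed

end

theorem theorem2:
  shows "\<exists>C::real. C > 0 \<and>
    (\<forall>(n::nat) (r::real vec) (c::real vec) (A::real mat) (\<epsilon>::real).
      r \<in> carrier_vec n \<longrightarrow> (\<forall>i<n. r $ i > 0) \<longrightarrow> (\<Sum>i<n. r $ i) = 1 \<longrightarrow>
      c \<in> carrier_vec n \<longrightarrow> (\<forall>j<n. c $ j > 0) \<longrightarrow> (\<Sum>j<n. c $ j) = 1 \<longrightarrow>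
      A \<in> carrier_mat n n \<longrightarrow> (\<forall>i<n. \<forall>j<n. A $$ (i, j) > 0) \<longrightarrow>
      \<epsilon> > 0 \<longrightarrow>
      (let s = (\<Sum>i<n. \<Sum>j<n. A $$ (i, j));
           l = Min {A $$ (i, j) | i j. i < n \<and> j < n}
       in \<exists>k x y B. sinkhorn A r c \<epsilon> = Some (k, x, y, B) \<and>
            vec_l1 (row_sums B - r) + vec_l1 (col_sums B - c) \<le> \<epsilon> \<and>
            real k \<le> C * (ln (s / l) / \<epsilon>\<^sup>2)))"
\<comment> \<open>The constant comes from \<open>iterations_bound\<close> and is uniform in the
  dimension and all inputs.\<close>
proof (intro exI[of _ 20] conjI allI impI)
  fix n :: nat and r c :: "real vec" and A :: "real mat" and \<epsilon> :: real
  assume "r \<in> carrier_vec n" "\<forall>i<n. r $ i > 0" "(\<Sum>i<n. r $ i) = 1"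
    "c \<in> carrier_vec n" "\<forall>j<n. c $ j > 0" "(\<Sum>j<n. c $ j) = 1"
    "A \<in> carrier_mat n n" "\<forall>i<n. \<forall>j<n. A $$ (i, j) > 0" and eps: "\<epsilon> > 0"
  then interpret sinkhorn_input n r c A
    by unfold_locales simp_all
  show "let s = (\<Sum>i<n. \<Sum>j<n. A $$ (i, j));
            l = Min {A $$ (i, j) | i j. i < n \<and> j < n}
        in \<exists>k x y B. sinkhorn A r c \<epsilon> = Some (k, x, y, B) \<and>
             vec_l1 (row_sums B - r) + vec_l1 (col_sums B - c) \<le> \<epsilon> \<and>
             real k \<le> 20 * (ln (s / l) / \<epsilon>\<^sup>2)"
  proof -
    obtain k x y B where "sinkhorn A r c \<epsilon> = Some (k, x, y, B)" "marginal_dist r c B \<le> \<epsilon>"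
      "real k \<le> 20 * (ln (total / least_entry) / \<epsilon>\<^sup>2)"
      using sinkhorn_converges[OF eps] .
    then show ?thesis
      unfolding Let_def marginal_dist_def total_def least_entry_def by blast
  qed
qed simp

end
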